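(* Let $\frac{a}{b} < \frac{c}{d}$ be non-negative fractions in lowest terms (with $b,d>0$) whose cross-determinant $bc-ad$ is a power of two, i.e. $bc - ad = 2^k$ for some integer $k \ge 0$. Then every rational number in the interval $\left[\frac{a}{b}, \frac{c}{d}\right]$ appears in the tree $T\left(\frac{a}{b}, \frac{c}{d}\right)$. Furthermore, there exists $L$ such that for all $i \ge L$ each pair of consecutive elements in $S_i\left(\frac{a}{b}, \frac{c}{d}\right)$ has cross-determinant $1$.
   Context: All fractions are written in lowest terms with positive denominator. The cross-determinant of two consecutive reduced fractions $\frac{p}{q}, \frac{r}{s}$ (in this order) is $qr - ps$. The mediant of two reduced fractions $\frac{p}{q}$ and $\frac{r}{s}$ is the fraction $\frac{p+r}{q+s}$ put in lowest terms. Given two non-negative rational numbers $\frac{a}{b} < \frac{c}{d}$ in lowest terms, define finite sequences (rows) $S_n\left(\frac{a}{b},\frac{c}{d}\right)$, $n \ge 0$, of reduced fractions: $S_0 = \left(\frac{a}{b}, \frac{c}{d}\right)$, and $S_{n+1}$ is obtained from $S_n$ by copying all terms and inserting between every two consecutive terms their (reduced) mediant, where the mediant is computed from the reduced forms of the two terms. The tree $T\left(\frac{a}{b},\frac{c}{d}\right)$ is the collection of all the rows $S_n\left(\frac{a}{b},\frac{c}{d}\right)$, $n\ge 0$; a rational number appears in the tree if it is a term of some row. *)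

theory Defs
  imports Complex_Main
begin

text \<open>Fractions are elements of \<^typ>\<open>rat\<close>; \<^const>\<open>quotient_of\<close> yields the numerator and the positive
  denominator of the representation in lowest terms.\<close>

definition num :: "rat \<Rightarrow> int" where
  "num x = fst (quotient_of x)"

definition den :: "rat \<Rightarrow> int" where
  "den x = snd (quotient_of x)"

definition cross_det :: "rat \<Rightarrow> rat \<Rightarrow> int" where
  "cross_det x y = den x * num y - num x * den y"

definition mediant :: "rat \<Rightarrow> rat \<Rightarrow> rat" where
  "mediant x y = Fract (num x + num y) (den x + den y)"

fun insert_mediants :: "rat list \<Rightarrow> rat list" where
  "insert_mediants (x # y # zs) = x # mediant x y # insert_mediants (y # zs)"
| "insert_mediants xs = xs"

primrec row :: "rat \<Rightarrow> rat \<Rightarrow> nat \<Rightarrow> rat list" where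
  "row x y 0 = [x, y]"
| "row x y (Suc n) = insert_mediants (row x y n)"

definition tree :: "rat \<Rightarrow> rat \<Rightarrow> rat list set" where
  "tree x y = range (row x y)"

definition appears_in :: "rat \<Rightarrow> rat list set \<Rightarrow> bool" where
  "appears_in q T \<longleftrightarrow> (\<exists>R\<in>T. q \<in> set R)"

lemma num_den_Fract:
  assumes "b > 0" "coprime a b"
  shows "num (Fract a b) = a" "den (Fract a b) = b"
  using assms by (simp_all add: num_def den_def quotient_of_Fract normalize_def)

lemma cross_det_Fract:
  assumes "b > 0" "d > 0" "coprime a b" "coprime c d"
  shows "cross_det (Fract a b) (Fract c d) = b * c - a * d"
  using assms by (simp add: cross_det_def num_den_Fract)

end

theory Submission
  imports Defs
begin

text \<open>If \<open>g\<close> is the factor cancelled in the mediant \<open>m\<close> of \<open>x < y\<close>, then the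
  cross-determinants of \<open>(x, m)\<close> and \<open>(m, y)\<close> are both that of \<open>(x, y)\<close> divided by \<open>g\<close>. When the
  latter is even, the vectors (numerator, denominator) of \<open>x\<close> and \<open>y\<close> are nonzero and
  proportional modulo 2, hence equal modulo 2, so \<open>g\<close> is even: a cross-determinant \<open>2 ^ k\<close> is at
  least halved in every row until it is 1. Every \<open>q\<close> in the interval is reached because
  the sum of the cross-determinants of \<open>(x, q)\<close> and \<open>(q, y)\<close>, for the consecutive terms \<open>x < q < y\<close>
  around \<open>q\<close>, strictly decreases from row to row.\<close>

lemma den_pos: "den x > 0"
  by (simp add: den_def quotient_of_denom_pos')

lemma coprime_num_den: "coprime (num x) (den x)"
  by (metis num_def den_def quotient_of_coprime prod.collapse)

lemma Fract_num_den: "Fract (num x) (den x) = x"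
  by (simp add: num_def den_def)

lemma cross_det_pos_iff: "cross_det x y > 0 \<longleftrightarrow> x < y"
proof -
  have "x < y \<longleftrightarrow> Fract (num x) (den x) < Fract (num y) (den y)"
    by (simp add: Fract_num_den)
  also have "\<dots> \<longleftrightarrow> (num x * den y) * (den x * den y) < (num y * den x) * (den x * den y)"
    by (intro less_rat) (use den_pos[of x] den_pos[of y] in auto)
  also have "\<dots> \<longleftrightarrow> num x * den y < num y * den x"
    using den_pos[of x] den_pos[of y] by (intro mult_less_cancel_right_pos) simp
  finally show ?thesis
    by (simp add: cross_det_def mult.commute)
qed

text \<open>The factor \<open>g\<close> is the gcd cancelled in the mediant. Multiplying it back
  keeps later computations free of division.\<close>

lemma mediant_reduction:
  obtains g where "g > 0" "num x + num y = g * num (mediant x y)"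
    "den x + den y = g * den (mediant x y)"
proof -
  let ?n = "num x + num y" and ?d = "den x + den y"
  have d: "?d > 0"
    using den_pos[of x] den_pos[of y] by simp
  then have g: "gcd ?n ?d > 0"
    by (simp add: gcd_pos_int)
  have "quotient_of (mediant x y) = (?n div gcd ?n ?d, ?d div gcd ?n ?d)"
    using d by (simp add: mediant_def quotient_of_Fract normalize_def Let_def)
  then have "?n = gcd ?n ?d * num (mediant x y)" "?d = gcd ?n ?d * den (mediant x y)"
    by (simp_all add: num_def den_def)
  with g show ?thesis
    by (rule that)
qed

text \<open>\<open>cross_det\<close> is bilinear and antisymmetric in the (numerator, denominator)
  vectors. Taking \<open>q\<close> to be an endpoint gives the halving, taking it to be the number
  sought gives the descent.\<close>

lemma
  assumes "num x + num y = g * num m" "den x + den y = g * den m"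
  shows mult_cross_det_right: "g * cross_det q m = cross_det q y - cross_det x q"
    and mult_cross_det_left: "g * cross_det m q = cross_det x q - cross_det q y"
proof -
  have "g * cross_det q m = den q * (g * num m) - num q * (g * den m)"
    by (simp add: cross_det_def algebra_simps)
  also have "\<dots> = cross_det q y - cross_det x q"
    unfolding assms[symmetric] by (simp add: cross_det_def algebra_simps)
  finally show *: "g * cross_det q m = cross_det q y - cross_det x q" .
  have "cross_det m q = - cross_det q m"
    by (simp add: cross_det_def)
  with * show "g * cross_det m q = cross_det x q - cross_det q y"
    by simp
qed

lemma cross_det_self: "cross_det x x = 0"
  by (simp add: cross_det_def)

lemma even_mediant_factor:
  assumes "even (cross_det x y)"
    and "num x + num y = g * num m" "den x + den y = g * den m"
  shows "even g"
proof -
  have not_both: "odd (num z) \<or> odd (den z)" for z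
    using coprime_num_den[of z] coprime_common_divisor[of "num z" "den z" 2] by auto
  have "even (num x + num y)" "even (den x + den y)"
    using assms(1) not_both[of x] not_both[of y] by (auto simp: cross_det_def)
  \<comment> \<open>\<open>m\<close> is in lowest terms, so one of its two coordinates is odd and
    the factor 2 must come from \<open>g\<close>.\<close>
  then show ?thesis
    using not_both[of m] unfolding assms(2,3) by auto
qed

text \<open>Divisibility replaces equality because \<open>g\<close> may contain more than one factor
  2. At \<open>k = 0\<close> truncated subtraction keeps the bound at 1.\<close>

lemma cross_det_mediant_dvd:
  assumes "x < y" "cross_det x y dvd 2 ^ k" "z = x \<and> w = mediant x y \<or> z = mediant x y \<and> w = y"
  shows "z < w \<and> cross_det z w dvd 2 ^ (k - 1)"
proof -
  obtain g where g: "g > 0" "num x + num y = g * num (mediant x y)"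
      "den x + den y = g * den (mediant x y)"
    by (rule mediant_reduction)
  have eq: "g * cross_det z w = cross_det x y"
    using assms(3) mult_cross_det_right[OF g(2,3), of x] mult_cross_det_left[OF g(2,3), of y]
    by (auto simp: cross_det_self)
  moreover have "cross_det x y > 0"
    using assms(1) by (simp add: cross_det_pos_iff)
  ultimately have "cross_det z w > 0"
    using g(1) by (metis zero_less_mult_pos)
  moreover have "cross_det z w dvd 2 ^ (k - 1)"
  proof (cases "even (cross_det x y)")
    case True
    then obtain h where h: "g = 2 * h"
      using even_mediant_factor[OF _ g(2,3)] by blast
    from True assms(2) have "k \<noteq> 0"
      by (metis dvd_trans odd_one power_0)
    then have "(2::int) ^ k = 2 * 2 ^ (k - 1)"
      by (simp flip: power_Suc)
    with assms(2) have "h * cross_det z w dvd 2 ^ (k - 1)"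
      by (simp add: h flip: eq)
    then show ?thesis
      by (rule dvd_mult_right)
  next
    case False
    \<comment> \<open>An odd divisor of a power of two is a unit, and so is its divisor
      \<open>cross_det z w\<close>.\<close>
    then have "is_unit (cross_det x y)"
      using assms(2) by (metis coprime_absorb_left coprime_power_right_iff coprime_right_2_iff_odd)
    then show ?thesis
      by (metis eq dvd_mult_right dvd_trans one_dvd)
  qed
  ultimately show ?thesis
    by (simp add: cross_det_pos_iff)
qed

lemma insert_mediants_Cons: "\<exists>ys. insert_mediants (x # xs) = x # ys"
  by (cases xs) auto

text \<open>Separate predicates \<open>P\<close> and \<open>Q\<close> let the bound tighten from one
  row to the next.\<close>

lemma successively_insert_mediants:
  assumes "successively P xs"
    and "\<And>x y. P x y \<Longrightarrow> Q x (mediant x y) \<and> Q (mediant x y) y"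
  shows "successively Q (insert_mediants xs)"
  using assms(1)
proof (induction xs rule: insert_mediants.induct)
  case (1 x y zs)
  obtain ys where "insert_mediants (y # zs) = y # ys"
    using insert_mediants_Cons by blast
  with 1 assms(2)[of x y] show ?case
    by simp
qed simp_all

lemma successively_row:
  assumes "x < y" "cross_det x y dvd 2 ^ k"
  shows "successively (\<lambda>z w. z < w \<and> cross_det z w dvd 2 ^ (k - n)) (row x y n)"
proof (induction n)
  case 0
  with assms show ?case
    by simp
next
  case (Suc n)
  show ?case
    unfolding row.simps
  proof (rule successively_insert_mediants[OF Suc.IH])
    fix z w assume "z < w \<and> cross_det z w dvd 2 ^ (k - n)"
    then show "(z < mediant z w \<and> cross_det z (mediant z w) dvd 2 ^ (k - Suc n)) \<and>
        (mediant z w < w \<and> cross_det (mediant z w) w dvd 2 ^ (k - Suc n))"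
      using cross_det_mediant_dvd[of z w "k - n"] by simp
  qed
qed

text \<open>Insertion from \<open>x\<close> onwards does not depend on the prefix. For nonempty
  \<open>us\<close>, the list \<open>us'\<close> ends in the mediant of the last entry of
  \<open>us\<close> with \<open>x\<close>.\<close>

lemma insert_mediants_append:
  "\<exists>us'. insert_mediants (us @ x # xs) = us' @ insert_mediants (x # xs)"
proof (induction us rule: insert_mediants.induct)
  case (1 u v us)
  then obtain us' where "insert_mediants ((v # us) @ x # xs) = us' @ insert_mediants (x # xs)"
    by blast
  then have "insert_mediants ((u # v # us) @ x # xs) =
      (u # mediant u v # us') @ insert_mediants (x # xs)"
    by simp
  then show ?case
    by blast
next
  case "2_1"
  have "insert_mediants ([] @ x # xs) = [] @ insert_mediants (x # xs)"
    by simp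
  then show ?case
    by blast
next
  case ("2_2" u)
  have "insert_mediants ([u] @ x # xs) = [u, mediant u x] @ insert_mediants (x # xs)"
    by simp
  then show ?case
    by blast
qed

lemma row_Suc_split:
  assumes "row a c n = us @ x # y # vs"
  shows "\<exists>us' vs'. row a c (Suc n) = us' @ x # mediant x y # y # vs'"
proof -
  obtain us' where "insert_mediants (us @ x # y # vs) = us' @ insert_mediants (x # y # vs)"
    using insert_mediants_append by blast
  moreover obtain vs' where "insert_mediants (y # vs) = y # vs'"
    using insert_mediants_Cons by blast
  ultimately have "row a c (Suc n) = us' @ x # mediant x y # y # vs'"
    using assms by simp
  then show ?thesis
    by blast
qed

lemma appears_between_neighbours:
  assumes "row a c n = us @ x # y # vs" "x < q" "q < y"
  shows "\<exists>n. q \<in> set (row a c n)"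
  using assms
proof (induction "nat (cross_det x q + cross_det q y)" arbitrary: n us x y vs rule: less_induct)
  case less
  let ?m = "mediant x y"
  obtain g where g: "g > 0" "num x + num y = g * num ?m" "den x + den y = g * den ?m"
    by (rule mediant_reduction)
  have pos: "cross_det x q > 0" "cross_det q y > 0"
    using less.prems by (simp_all add: cross_det_pos_iff)
  have le: "t \<le> g * t" if "t > 0" for t
    using g(1) that by simp
  obtain us' vs' where row: "row a c (Suc n) = us' @ x # ?m # y # vs'"
    using row_Suc_split[OF less.prems(1)] by blast
  consider "q < ?m" | "q = ?m" | "?m < q"
    by linarith
  then show ?case
  proof cases
    case 1
    \<comment> \<open>Since \<open>q < ?m\<close>, the left side is positive, so the factor
      \<open>g \<ge> 1\<close> may be dropped from the identity. The new sum is then at most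
      \<open>cross_det q y\<close>.\<close>
    then have "cross_det q ?m \<le> cross_det q y - cross_det x q"
      using le mult_cross_det_right[OF g(2,3)] by (metis cross_det_pos_iff)
    with pos have "nat (cross_det x q + cross_det q ?m) < nat (cross_det x q + cross_det q y)"
      by linarith
    from less.hyps[OF this row less.prems(2) 1] show ?thesis .
  next
    case 2
    with row have "q \<in> set (row a c (Suc n))"
      by simp
    then show ?thesis
      by blast
  next
    case 3
    then have "cross_det ?m q \<le> cross_det x q - cross_det q y"
      using le mult_cross_det_left[OF g(2,3)] by (metis cross_det_pos_iff)
    with pos have "nat (cross_det ?m q + cross_det q y) < nat (cross_det x q + cross_det q y)"
      by linarith
    moreover have "row a c (Suc n) = (us' @ [x]) @ ?m # y # vs'"
      using row by simp
    ultimately show ?thesis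
      using less.hyps 3 less.prems(3) by blast
  qed
qed

lemma appears_in_tree:
  assumes "x \<le> q" "q \<le> y"
  shows "appears_in q (tree x y)"
proof -
  have "\<exists>n. q \<in> set (row x y n)"
  proof (cases "q \<in> {x, y}")
    case True
    then have "q \<in> set (row x y 0)"
      by simp
    then show ?thesis
      by blast
  next
    case False
    with assms show ?thesis
      using appears_between_neighbours[of x y 0 "[]" x y "[]"] by simp
  qed
  then show ?thesis
    by (auto simp: appears_in_def tree_def)
qed

theorem theorem3p2:
  fixes a b c d :: int and k :: nat
  assumes "0 \<le> a" and "0 \<le> c" and "0 < b" and "0 < d"
    and "coprime a b" and "coprime c d"
    and "Fract a b < Fract c d"
    and "b * c - a * d = 2 ^ k"
  shows "(\<forall>q :: rat. q \<in> {Fract a b .. Fract c d} \<longrightarrow> appears_in q (tree (Fract a b) (Fract c d)))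
    \<and> (\<exists>L :: nat. \<forall>i \<ge> L. \<forall>j. Suc j < length (row (Fract a b) (Fract c d) i) \<longrightarrow>
          cross_det (row (Fract a b) (Fract c d) i ! j) (row (Fract a b) (Fract c d) i ! Suc j) = 1)"
proof (intro conjI allI impI exI)
  let ?x = "Fract a b" and ?y = "Fract c d"
  fix q assume "q \<in> {?x..?y}"
  then show "appears_in q (tree ?x ?y)"
    by (simp add: appears_in_tree)
next
  let ?x = "Fract a b" and ?y = "Fract c d"
  fix i j :: nat
  \<comment> \<open>This fixes the witness for \<open>L\<close> as \<open>k\<close>: from row
    \<open>k\<close> on the exponent \<open>k - i\<close> is 0, and a positive divisor of 1 is
    1.\<close>
  assume "k \<le> i" and j: "Suc j < length (row ?x ?y i)"
  have "cross_det ?x ?y dvd 2 ^ k"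
    using assms by (simp add: cross_det_Fract)
  with assms(7) have "successively (\<lambda>z w. z < w \<and> cross_det z w dvd 2 ^ (k - i)) (row ?x ?y i)"
    by (rule successively_row)
  with j \<open>k \<le> i\<close> have "cross_det (row ?x ?y i ! j) (row ?x ?y i ! Suc j) > 0"
      "cross_det (row ?x ?y i ! j) (row ?x ?y i ! Suc j) dvd 1"
    by (simp_all add: successively_conv_nth cross_det_pos_iff)
  then show "cross_det (row ?x ?y i ! j) (row ?x ?y i ! Suc j) = 1"
    by simp
qed

end
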